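(* For any double quasi-posets $P,Q$, put $$P\unlhd Q=\sum_{f\in I(P,Q)}P\times_f Q,\qquad P\lhd Q=\sum_{f\in I_<(P,Q)}P\times_f Q,$$ and extend these products bilinearly to $\mathcal{H}_{\mathbf{dqp}}$. Then both $\unlhd$ and $\lhd$ are associative and, for all $x,y,z\in\mathcal{H}_{\mathbf{dqp}}$: $$\langle x\unlhd y,z\rangle=\langle x,y\unlhd z\rangle,\qquad \langle x\lhd y,z\rangle_<=\langle x,y\lhd z\rangle_<.$$
   Context: Fix an arbitrary field $K$. For a preorder $\leq_a$, write $i\sim_a j$ if $i\leq_a j$ and $j\leq_a i$, and $i<_a j$ if $i\leq_a j$ and not $i\sim_a j$. A double quasi-poset is a triple $P=(V(P),\leq_1,\leq_2)$ with $V(P)$ a finite set and $\leq_1,\leq_2$ two preorders on $V(P)$. An isomorphism is a bijection preserving and reflecting both preorders. $\mathbf{dqp}$ is the set of isomorphism classes of double quasi-posets, and $\mathcal{H}_{\mathbf{dqp}}$ is the $K$-vector space with basis $\mathbf{dqp}$. For a bijection $f:V(P)\to V(Q)$, the product of $P$ and $Q$ over $f$ is the double quasi-poset $P\times_f Q=(V(P),\leq_1^f,\leq_2)$, where $i\leq_1^f j$ iff $f(i)\leq_1 f(j)$ in $Q$, and $\leq_2$ is the second preorder of $P$. $I_<(P,Q)$ (semi-prepictures) is the set of bijections $f:V(P)\to V(Q)$ such that for all $i,j\in V(P)$, $i<_1 j\Rightarrow f(i)<_2 f(j)$. $I(P,Q)$ (semi-pictures) is the set of bijections $f:V(P)\to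 V(Q)$ such that for all $i,j\in V(P)$, $i<_1 j\Rightarrow f(i)<_2 f(j)$ and $i\leq_1 j\Rightarrow f(i)\leq_2 f(j)$. (These sets are empty when the cardinalities differ.) A prepicture between $P$ and $Q$ is a bijection $f:V(P)\to V(Q)$ such that for all $i,j\in V(P)$: $i<_1 j\Rightarrow f(i)<_2 f(j)$, and $f(i)<_1 f(j)\Rightarrow i<_2 j$. A picture is a prepicture such that moreover for all $i,j$: $i\leq_1 j\Rightarrow f(i)\leq_2 f(j)$, and $f(i)\leq_1 f(j)\Rightarrow i\leq_2 j$. The sets of prepictures and pictures are $Pic_<(P,Q)$ and $Pic(P,Q)$. The bilinear forms $\langle-,-\rangle$ and $\langle-,-\rangle_<$ on $\mathcal{H}_{\mathbf{dqp}}$ are defined by $\langle P,Q\rangle=\sharp Pic(P,Q)$ and $\langle P,Q\rangle_<=\sharp Pic_<(P,Q)$ for $P,Q\in\mathbf{dqp}$. *)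

theory Defs
  imports Complex_Main "HOL-Library.FuncSet" "HOL-Library.Poly_Mapping"
begin

section \<open>Double quasi-posets\<close>

record 'a double_quasi_poset =
  verts :: "'a set"
  le1 :: "'a rel"
  le2 :: "'a rel"

definition is_dqp :: "'a double_quasi_poset \<Rightarrow> bool" where
  "is_dqp P \<longleftrightarrow> finite (verts P) \<and> preorder_on (verts P) (le1 P) \<and> preorder_on (verts P) (le2 P)"

definition equiv_wrt :: "'a rel \<Rightarrow> 'a \<Rightarrow> 'a \<Rightarrow> bool" where
  "equiv_wrt r i j \<longleftrightarrow> (i, j) \<in> r \<and> (j, i) \<in> r"

definition less_wrt :: "'a rel \<Rightarrow> 'a \<Rightarrow> 'a \<Rightarrow> bool" where
  "less_wrt r i j \<longleftrightarrow> (i, j) \<in> r \<and> \<not> equiv_wrt r i j"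

text \<open>Maps are taken extensional (equal to \<^const>\<open>undefined\<close> off their domain), so that
  a bijection between two sets is counted exactly once.\<close>

definition bijections :: "'a set \<Rightarrow> 'b set \<Rightarrow> ('a \<Rightarrow> 'b) set" where
  "bijections A B = {f \<in> extensional A. bij_betw f A B}"

definition isos :: "'a double_quasi_poset \<Rightarrow> 'b double_quasi_poset \<Rightarrow> ('a \<Rightarrow> 'b) set" where
  "isos P Q = {f \<in> bijections (verts P) (verts Q). \<forall>i\<in>verts P. \<forall>j\<in>verts P.
     ((i, j) \<in> le1 P \<longleftrightarrow> (f i, f j) \<in> le1 Q) \<and>
     ((i, j) \<in> le2 P \<longleftrightarrow> (f i, f j) \<in> le2 Q)}"

definition dqp_iso :: "'a double_quasi_poset \<Rightarrow> 'b double_quasi_poset \<Rightarrow> bool" where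
  "dqp_iso P Q \<longleftrightarrow> isos P Q \<noteq> {}"

definition prod_over ::
  "'a double_quasi_poset \<Rightarrow> ('a \<Rightarrow> 'b) \<Rightarrow> 'b double_quasi_poset \<Rightarrow> 'a double_quasi_poset" where
  "prod_over P f Q =
     \<lparr>verts = verts P,
      le1 = {(i, j). i \<in> verts P \<and> j \<in> verts P \<and> (f i, f j) \<in> le1 Q},
      le2 = le2 P\<rparr>"

definition semi_prepictures ::
  "'a double_quasi_poset \<Rightarrow> 'b double_quasi_poset \<Rightarrow> ('a \<Rightarrow> 'b) set" where
  "semi_prepictures P Q = {f \<in> bijections (verts P) (verts Q). \<forall>i\<in>verts P. \<forall>j\<in>verts P.
     less_wrt (le1 P) i j \<longrightarrow> less_wrt (le2 Q) (f i) (f j)}"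

definition semi_pictures ::
  "'a double_quasi_poset \<Rightarrow> 'b double_quasi_poset \<Rightarrow> ('a \<Rightarrow> 'b) set" where
  "semi_pictures P Q = {f \<in> bijections (verts P) (verts Q). \<forall>i\<in>verts P. \<forall>j\<in>verts P.
     (less_wrt (le1 P) i j \<longrightarrow> less_wrt (le2 Q) (f i) (f j)) \<and>
     ((i, j) \<in> le1 P \<longrightarrow> (f i, f j) \<in> le2 Q)}"

definition prepictures ::
  "'a double_quasi_poset \<Rightarrow> 'b double_quasi_poset \<Rightarrow> ('a \<Rightarrow> 'b) set" where
  "prepictures P Q = {f \<in> bijections (verts P) (verts Q). \<forall>i\<in>verts P. \<forall>j\<in>verts P.
     (less_wrt (le1 P) i j \<longrightarrow> less_wrt (le2 Q) (f i) (f j)) \<and>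
     (less_wrt (le1 Q) (f i) (f j) \<longrightarrow> less_wrt (le2 P) i j)}"

definition pictures ::
  "'a double_quasi_poset \<Rightarrow> 'b double_quasi_poset \<Rightarrow> ('a \<Rightarrow> 'b) set" where
  "pictures P Q = {f \<in> prepictures P Q. \<forall>i\<in>verts P. \<forall>j\<in>verts P.
     ((i, j) \<in> le1 P \<longrightarrow> (f i, f j) \<in> le2 Q) \<and>
     ((f i, f j) \<in> le1 Q \<longrightarrow> (i, j) \<in> le2 P)}"


section \<open>Transport along isomorphisms\<close>

definition transport ::
  "('a \<Rightarrow> 'c) \<Rightarrow> ('b \<Rightarrow> 'd) \<Rightarrow> 'a set \<Rightarrow> 'c set \<Rightarrow> ('a \<Rightarrow> 'b) \<Rightarrow> 'c \<Rightarrow> 'd" where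
  "transport p q A C f = restrict (\<lambda>i. q (f (inv_into A p i))) C"

lemma isosD:
  assumes "p \<in> isos P P'"
  shows "bij_betw p (verts P) (verts P')" and "p \<in> extensional (verts P)"
    and "\<And>i. i \<in> verts P \<Longrightarrow> p i \<in> verts P'"
    and "\<And>i j. i \<in> verts P \<Longrightarrow> j \<in> verts P \<Longrightarrow> (p i, p j) \<in> le1 P' \<longleftrightarrow> (i, j) \<in> le1 P"
    and "\<And>i j. i \<in> verts P \<Longrightarrow> j \<in> verts P \<Longrightarrow> (p i, p j) \<in> le2 P' \<longleftrightarrow> (i, j) \<in> le2 P"
  using assms by (auto simp: isos_def bijections_def bij_betw_apply)

lemma isos_less:
  assumes "p \<in> isos P P'" "i \<in> verts P" "j \<in> verts P"
  shows "less_wrt (le1 P') (p i) (p j) \<longleftrightarrow> less_wrt (le1 P) i j"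
    and "less_wrt (le2 P') (p i) (p j) \<longleftrightarrow> less_wrt (le2 P) i j"
  using assms by (simp_all add: less_wrt_def equiv_wrt_def isosD(4,5)[OF assms(1)])

lemma isos_inv:
  assumes "p \<in> isos P P'"
  shows "restrict (inv_into (verts P) p) (verts P') \<in> isos P' P"
proof -
  note b = isosD(1)[OF assms]
  let ?q = "inv_into (verts P) p"
  have q: "?q i \<in> verts P" "p (?q i) = i" if "i \<in> verts P'" for i
    using b that by (auto simp: bij_betw_def inv_into_into f_inv_into_f)
  have "bij_betw (restrict ?q (verts P')) (verts P') (verts P)"
    using bij_betw_inv_into[OF b] by (simp cong: bij_betw_cong)
  moreover have "((i, j) \<in> le1 P' \<longleftrightarrow> (?q i, ?q j) \<in> le1 P) \<and> ((i, j) \<in> le2 P' \<longleftrightarrow> (?q i, ?q j) \<in> le2 P)"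
    if "i \<in> verts P'" "j \<in> verts P'" for i j
    using isosD(4,5)[OF assms, of "?q i" "?q j"] q that by simp
  ultimately show ?thesis
    by (auto simp: isos_def bijections_def)
qed

lemma isos_comp:
  assumes p: "p \<in> isos P Q" and q: "q \<in> isos Q R"
  shows "restrict (q \<circ> p) (verts P) \<in> isos P R"
proof -
  have "bij_betw (restrict (q \<circ> p) (verts P)) (verts P) (verts R)"
    using bij_betw_trans[OF isosD(1)[OF p] isosD(1)[OF q]] by (simp cong: bij_betw_cong)
  then show ?thesis
    using isosD[OF p] isosD[OF q] by (auto simp: isos_def bijections_def)
qed

lemma dqp_iso_refl: "dqp_iso P P"
proof -
  have "restrict id (verts P) \<in> isos P P"
    by (auto simp: isos_def bijections_def bij_betw_def inj_on_def)
  then show ?thesis by (auto simp: dqp_iso_def)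
qed

lemma dqp_iso_sym: "dqp_iso P Q \<Longrightarrow> dqp_iso Q P"
  using isos_inv by (fastforce simp: dqp_iso_def)

lemma dqp_iso_trans: "dqp_iso P Q \<Longrightarrow> dqp_iso Q R \<Longrightarrow> dqp_iso P R"
  using isos_comp by (fastforce simp: dqp_iso_def)

lemma transport_apply:
  assumes "p \<in> isos P P'" "i \<in> verts P"
  shows "transport p q (verts P) (verts P') f (p i) = q (f i)"
  using isosD(1,3)[OF assms(1)] assms(2)
  by (simp add: transport_def bij_betw_def inv_into_f_f)

lemma transport_bijections:
  assumes p: "p \<in> isos P P'" and q: "q \<in> isos Q Q'"
    and f: "f \<in> bijections (verts P) (verts Q)"
  shows "transport p q (verts P) (verts P') f \<in> bijections (verts P') (verts Q')"
proof -
  have "bij_betw (q \<circ> (f \<circ> inv_into (verts P) p)) (verts P') (verts Q')"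
    using f bij_betw_inv_into[OF isosD(1)[OF p]] isosD(1)[OF q]
    by (auto simp: bijections_def intro!: bij_betw_trans)
  then have "bij_betw (transport p q (verts P) (verts P') f) (verts P') (verts Q')"
    by (simp add: transport_def comp_def cong: bij_betw_cong)
  then show ?thesis by (simp add: bijections_def transport_def)
qed

lemma transport_inverse:
  assumes p: "p \<in> isos P P'" and q: "q \<in> isos Q Q'"
    and f: "f \<in> bijections (verts P) (verts Q)"
  shows "transport (restrict (inv_into (verts P) p) (verts P'))
      (restrict (inv_into (verts Q) q) (verts Q')) (verts P') (verts P)
      (transport p q (verts P) (verts P') f) = f"  (is "transport ?p' ?q' _ _ ?g = f")
proof (rule extensionalityI[of _ "verts P"])
  show "transport ?p' ?q' (verts P') (verts P) ?g \<in> extensional (verts P)"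
    by (simp add: transport_def)
  show "f \<in> extensional (verts P)" using f by (simp add: bijections_def)
  fix i assume i: "i \<in> verts P"
  have fi: "f i \<in> verts Q" using f i by (auto simp: bijections_def bij_betw_apply)
  have pi: "?p' (p i) = i" and qi: "?q' (q (f i)) = f i"
    using i fi isosD(1,3)[OF p] isosD(1,3)[OF q] by (auto simp: bij_betw_def inv_into_f_f)
  have "transport ?p' ?q' (verts P') (verts P) ?g (?p' (p i)) = ?q' (?g (p i))"
    by (rule transport_apply[OF isos_inv[OF p] isosD(3)[OF p i]])
  also have "\<dots> = f i" by (simp only: transport_apply[OF p i] qi)
  finally show "transport ?p' ?q' (verts P') (verts P) ?g i = f i" by (simp only: pi)
qed

lemma pics_subset:
  "semi_pictures P Q \<subseteq> bijections (verts P) (verts Q)"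
  "semi_prepictures P Q \<subseteq> bijections (verts P) (verts Q)"
  "pictures P Q \<subseteq> bijections (verts P) (verts Q)"
  "prepictures P Q \<subseteq> bijections (verts P) (verts Q)"
  by (auto simp: semi_pictures_def semi_prepictures_def pictures_def prepictures_def)

lemma ball_verts_iso:
  assumes p: "p \<in> isos P P'"
  shows "(\<forall>i\<in>verts P'. \<forall>j\<in>verts P'. R i j) \<longleftrightarrow> (\<forall>i\<in>verts P. \<forall>j\<in>verts P. R (p i) (p j))"
proof -
  have "verts P' = p ` verts P" using isosD(1)[OF p] by (simp add: bij_betw_def)
  then show ?thesis by simp
qed

context
  fixes P :: "'a double_quasi_poset" and P' :: "'c double_quasi_poset"
    and Q :: "'b double_quasi_poset" and Q' :: "'d double_quasi_poset" and p q
  assumes p: "p \<in> isos P P'" and q: "q \<in> isos Q Q'"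
begin

private abbreviation (input) "T \<equiv> transport p q (verts P) (verts P')"

private lemma app: "f \<in> bijections (verts P) (verts Q) \<Longrightarrow> i \<in> verts P \<Longrightarrow> f i \<in> verts Q"
  by (auto simp: bijections_def bij_betw_apply)

lemma transport_semi_prepictures:
  "f \<in> semi_prepictures P Q \<Longrightarrow> T f \<in> semi_prepictures P' Q'"
  by (simp add: semi_prepictures_def ball_verts_iso[OF p] transport_bijections[OF p q]
      transport_apply[OF p] app isos_less[OF p] isos_less[OF q])

lemma transport_semi_pictures:
  "f \<in> semi_pictures P Q \<Longrightarrow> T f \<in> semi_pictures P' Q'"
  by (simp add: semi_pictures_def ball_verts_iso[OF p] transport_bijections[OF p q]
      transport_apply[OF p] app isos_less[OF p] isos_less[OF q] isosD(4,5)[OF p] isosD(4,5)[OF q])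

lemma transport_prepictures:
  "f \<in> prepictures P Q \<Longrightarrow> T f \<in> prepictures P' Q'"
  by (simp add: prepictures_def ball_verts_iso[OF p] transport_bijections[OF p q]
      transport_apply[OF p] app isos_less[OF p] isos_less[OF q])

lemma transport_pictures:
  "f \<in> pictures P Q \<Longrightarrow> T f \<in> pictures P' Q'"
  by (simp add: pictures_def prepictures_def ball_verts_iso[OF p] transport_bijections[OF p q]
      transport_apply[OF p] app isos_less[OF p] isos_less[OF q] isosD(4,5)[OF p] isosD(4,5)[OF q])

lemma transport_prod_over:
  assumes f: "f \<in> bijections (verts P) (verts Q)"
  shows "dqp_iso (prod_over P f Q) (prod_over P' (T f) Q')"
proof -
  have "p \<in> isos (prod_over P f Q) (prod_over P' (T f) Q')"
    using p isosD(3)[OF p] by (simp add: isos_def prod_over_def transport_apply[OF p]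
      app[OF f] isosD(4)[OF q])
  then show ?thesis by (auto simp: dqp_iso_def)
qed

end

lemma transport_bij_betw:
  assumes p: "p \<in> isos P P'" and q: "q \<in> isos Q Q'"
    and sub: "S \<subseteq> bijections (verts P) (verts Q)" "S' \<subseteq> bijections (verts P') (verts Q')"
    and fwd: "\<And>f. f \<in> S \<Longrightarrow> transport p q (verts P) (verts P') f \<in> S'"
    and bwd: "\<And>p' q' g. p' \<in> isos P' P \<Longrightarrow> q' \<in> isos Q' Q \<Longrightarrow> g \<in> S' \<Longrightarrow>
      transport p' q' (verts P') (verts P) g \<in> S"
  shows "bij_betw (transport p q (verts P) (verts P')) S S'"
proof -
  let ?p' = "restrict (inv_into (verts P) p) (verts P')"
  let ?q' = "restrict (inv_into (verts Q) q) (verts Q')"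
  have inv: "restrict (inv_into (verts A') (restrict (inv_into (verts A) r) (verts A'))) (verts A) = r"
    if r: "r \<in> isos A A'" for A :: "'e double_quasi_poset" and A' :: "'f double_quasi_poset" and r
  proof (rule extensionalityI[of _ "verts A"])
    fix i assume i: "i \<in> verts A"
    let ?r' = "restrict (inv_into (verts A) r) (verts A')"
    have "?r' (r i) = i" "r i \<in> verts A'"
      using i isosD(1,3)[OF r] by (auto simp: bij_betw_def inv_into_f_f)
    then show "restrict (inv_into (verts A') ?r') (verts A) i = r i"
      using i isosD(1)[OF isos_inv[OF r]] inv_into_f_f[of ?r' "verts A'" "r i"]
      by (simp add: bij_betw_def)
  qed (use isosD(2)[OF r] in auto)
  show ?thesis
  proof (rule bij_betw_byWitness[where f' = "transport ?p' ?q' (verts P') (verts P)"])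
    show "\<forall>f\<in>S. transport ?p' ?q' (verts P') (verts P) (transport p q (verts P) (verts P') f) = f"
      using transport_inverse[OF p q] sub(1) by blast
    show "\<forall>g\<in>S'. transport p q (verts P) (verts P') (transport ?p' ?q' (verts P') (verts P) g) = g"
      using transport_inverse[OF isos_inv[OF p] isos_inv[OF q]] sub(2)
      unfolding inv[OF p] inv[OF q] by blast
    show "transport p q (verts P) (verts P') ` S \<subseteq> S'" using fwd by blast
    show "transport ?p' ?q' (verts P') (verts P) ` S' \<subseteq> S"
      using bwd[OF isos_inv[OF p] isos_inv[OF q]] by blast
  qed
qed

lemma is_dqp_prod_over:
  assumes "is_dqp P" "is_dqp Q" "f \<in> bijections (verts P) (verts Q)"
  shows "is_dqp (prod_over P f Q)"
  using assms
  by (auto simp: is_dqp_def prod_over_def preorder_on_def refl_on_def bijections_def bij_betw_apply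
      intro!: transI elim: transE)

lemma finite_bijections: "finite A \<Longrightarrow> finite B \<Longrightarrow> finite (bijections A B)"
  by (rule finite_subset[OF _ finite_PiE[of A "\<lambda>_. B"]])
    (auto simp: bijections_def PiE_def bij_betw_apply)


section \<open>Isomorphism classes\<close>

text \<open>Every double quasi-poset is isomorphic to one whose vertices are natural numbers (lemma
  \<open>dqp_iso_nat\<close> below), so the following type has one element for each isomorphism class.\<close>

definition dqp_rel :: "nat double_quasi_poset \<Rightarrow> nat double_quasi_poset \<Rightarrow> bool" where
  "dqp_rel P Q \<longleftrightarrow> is_dqp P \<and> is_dqp Q \<and> dqp_iso P Q"

lemma part_equivp_dqp_rel: "part_equivp dqp_rel"
proof (rule part_equivpI)
  have "dqp_rel \<lparr>verts = {}, le1 = {}, le2 = {}\<rparr> \<lparr>verts = {}, le1 = {}, le2 = {}\<rparr>"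
    by (simp add: dqp_rel_def is_dqp_def dqp_iso_refl)
  then show "\<exists>P. dqp_rel P P" by blast
qed (auto simp: dqp_rel_def intro!: sympI transpI intro: dqp_iso_sym dqp_iso_trans)

quotient_type dqp = "nat double_quasi_poset" / partial: dqp_rel
  by (rule part_equivp_dqp_rel)

lemma dqp_iso_nat:
  fixes P :: "'a double_quasi_poset"
  assumes "is_dqp P"
  shows "\<exists>Q :: nat double_quasi_poset. is_dqp Q \<and> dqp_iso P Q"
proof -
  obtain h :: "'a \<Rightarrow> nat" where h: "bij_betw h (verts P) {0..<card (verts P)}"
    using assms ex_bij_betw_finite_nat unfolding is_dqp_def by blast
  define g where "g = restrict h (verts P)"
  define Q where "Q = \<lparr>verts = g ` verts P, le1 = map_prod g g ` le1 P, le2 = map_prod g g ` le2 P\<rparr>"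
  have inj: "inj_on g (verts P)"
    using h by (auto simp: bij_betw_def inj_on_def g_def)
  have pre: "preorder_on (g ` verts P) (map_prod g g ` r)"
    and mem: "\<And>i j. i \<in> verts P \<Longrightarrow> j \<in> verts P \<Longrightarrow> (g i, g j) \<in> map_prod g g ` r \<longleftrightarrow> (i, j) \<in> r"
    if r: "preorder_on (verts P) r" for r
  proof -
    have sub: "r \<subseteq> verts P \<times> verts P" and rf: "\<And>i. i \<in> verts P \<Longrightarrow> (i, i) \<in> r" and tr: "trans r"
      using r by (auto simp: preorder_on_def refl_on_def)
    show mem: "(g i, g j) \<in> map_prod g g ` r \<longleftrightarrow> (i, j) \<in> r" if "i \<in> verts P" "j \<in> verts P" for i j
    proof
      assume "(g i, g j) \<in> map_prod g g ` r"
      then obtain a b where ab: "(a, b) \<in> r" "g i = g a" "g j = g b" by auto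
      then have "i = a" "j = b" using that sub inj by (auto dest: inj_onD)
      then show "(i, j) \<in> r" using ab by simp
    qed force
    have "trans (map_prod g g ` r)"
    proof (rule transI)
      fix x y z assume "(x, y) \<in> map_prod g g ` r" "(y, z) \<in> map_prod g g ` r"
      then obtain a b c d where *: "(a, b) \<in> r" "(c, d) \<in> r" "x = g a" "y = g b" "y = g c" "z = g d"
        by auto
      then have "b = c" using inj sub by (auto simp: inj_on_def)
      then show "(x, z) \<in> map_prod g g ` r" using * transD[OF tr] by auto
    qed
    then show "preorder_on (g ` verts P) (map_prod g g ` r)"
      using sub rf by (auto simp: preorder_on_def refl_on_def)
  qed
  have "is_dqp Q" using assms pre by (simp add: is_dqp_def Q_def)
  moreover have "g \<in> isos P Q"
    using assms inj by (simp add: isos_def bijections_def Q_def is_dqp_def mem bij_betw_def)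
      (simp add: g_def)
  ultimately show ?thesis by (auto simp: dqp_iso_def)
qed


section \<open>Products and pairings on the vector space with basis the isomorphism classes\<close>

lemma sum_prod_over_cong:
  fixes S :: "nat double_quasi_poset \<Rightarrow> nat double_quasi_poset \<Rightarrow> (nat \<Rightarrow> nat) set"
  assumes r: "dqp_rel P P'" "dqp_rel Q Q'"
    and sub: "\<And>P Q. S P Q \<subseteq> bijections (verts P) (verts Q)"
    and tr: "\<And>P P' Q Q' p q f. p \<in> isos P P' \<Longrightarrow> q \<in> isos Q Q' \<Longrightarrow> f \<in> S P Q \<Longrightarrow>
      transport p q (verts P) (verts P') f \<in> S P' Q'"
  shows "(\<Sum>f\<in>S P Q. Poly_Mapping.single (abs_dqp (prod_over P f Q)) 1) =
    (\<Sum>f\<in>S P' Q'. Poly_Mapping.single (abs_dqp (prod_over P' f Q')) (1 :: 'k::field))"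
proof -
  obtain p q where p: "p \<in> isos P P'" and q: "q \<in> isos Q Q'"
    using r by (auto simp: dqp_rel_def dqp_iso_def)
  let ?T = "transport p q (verts P) (verts P')"
  have bij: "bij_betw ?T (S P Q) (S P' Q')"
    by (rule transport_bij_betw[OF p q sub sub]) (auto intro: tr p q)
  have "abs_dqp (prod_over P f Q) = abs_dqp (prod_over P' (?T f) Q')" if "f \<in> S P Q" for f
  proof -
    have f: "f \<in> bijections (verts P) (verts Q)" using sub that by blast
    have "dqp_rel (prod_over P f Q) (prod_over P' (?T f) Q')"
      using r f transport_bijections[OF p q f] transport_prod_over[OF p q f]
      by (simp add: dqp_rel_def is_dqp_prod_over)
    then show ?thesis by (rule Quotient3_rel_abs[OF Quotient3_dqp])
  qed
  then show ?thesis
    unfolding sum.reindex_bij_betw[OF bij, symmetric] by simp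
qed

lemma card_pictures_cong:
  assumes r: "dqp_rel P P'" "dqp_rel Q Q'"
  shows "card (pictures P Q) = card (pictures P' Q')"
    and "card (prepictures P Q) = card (prepictures P' Q')"
proof -
  obtain p q where p: "p \<in> isos P P'" and q: "q \<in> isos Q Q'"
    using r by (auto simp: dqp_rel_def dqp_iso_def)
  show "card (pictures P Q) = card (pictures P' Q')"
    by (rule bij_betw_same_card[OF transport_bij_betw[OF p q]])
      (rule pics_subset transport_pictures p q | assumption)+
  show "card (prepictures P Q) = card (prepictures P' Q')"
    by (rule bij_betw_same_card[OF transport_bij_betw[OF p q]])
      (rule pics_subset transport_prepictures p q | assumption)+
qed

lift_definition unlhd_basis :: "dqp \<Rightarrow> dqp \<Rightarrow> (dqp \<Rightarrow>\<^sub>0 'k::field)"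
  is "\<lambda>P Q. \<Sum>f\<in>semi_pictures P Q. Poly_Mapping.single (abs_dqp (prod_over P f Q)) 1"
  by (rule sum_prod_over_cong)
    (assumption | rule transport_semi_pictures | rule pics_subset)+

lift_definition lhd_basis :: "dqp \<Rightarrow> dqp \<Rightarrow> (dqp \<Rightarrow>\<^sub>0 'k::field)"
  is "\<lambda>P Q. \<Sum>f\<in>semi_prepictures P Q. Poly_Mapping.single (abs_dqp (prod_over P f Q)) 1"
  by (rule sum_prod_over_cong)
    (assumption | rule transport_semi_prepictures | rule pics_subset)+

lift_definition num_pictures :: "dqp \<Rightarrow> dqp \<Rightarrow> nat"
  is "\<lambda>P Q. card (pictures P Q)"
  by (rule card_pictures_cong)

lift_definition num_prepictures :: "dqp \<Rightarrow> dqp \<Rightarrow> nat"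
  is "\<lambda>P Q. card (prepictures P Q)"
  by (rule card_pictures_cong)

text \<open>The space \<open>dqp \<Rightarrow>\<^sub>0 'k\<close> of finitely supported functions has the basis
  \<open>Poly_Mapping.single p 1\<close>, with \<open>p\<close> ranging over the isomorphism classes. The map \<open>s\<close> below is
  the scalar multiplication of the target space.\<close>

definition scale :: "'k::field \<Rightarrow> (dqp \<Rightarrow>\<^sub>0 'k) \<Rightarrow> (dqp \<Rightarrow>\<^sub>0 'k)" where
  "scale c = Poly_Mapping.map ((*) c)"

definition bilinear_ext :: "('k::field \<Rightarrow> 'v \<Rightarrow> 'v::comm_monoid_add) \<Rightarrow> (dqp \<Rightarrow> dqp \<Rightarrow> 'v) \<Rightarrow>
    (dqp \<Rightarrow>\<^sub>0 'k) \<Rightarrow> (dqp \<Rightarrow>\<^sub>0 'k) \<Rightarrow> 'v" where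
  "bilinear_ext s B x y =
     (\<Sum>p\<in>Poly_Mapping.keys x. \<Sum>q\<in>Poly_Mapping.keys y.
        s (Poly_Mapping.lookup x p * Poly_Mapping.lookup y q) (B p q))"

definition unlhd :: "(dqp \<Rightarrow>\<^sub>0 'k::field) \<Rightarrow> (dqp \<Rightarrow>\<^sub>0 'k) \<Rightarrow> (dqp \<Rightarrow>\<^sub>0 'k)" (infixl \<open>\<unlhd>\<close> 70) where
  "x \<unlhd> y = bilinear_ext scale unlhd_basis x y"

definition lhd :: "(dqp \<Rightarrow>\<^sub>0 'k::field) \<Rightarrow> (dqp \<Rightarrow>\<^sub>0 'k) \<Rightarrow> (dqp \<Rightarrow>\<^sub>0 'k)" (infixl \<open>\<lhd>\<close> 70) where
  "x \<lhd> y = bilinear_ext scale lhd_basis x y"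

definition pic_form :: "(dqp \<Rightarrow>\<^sub>0 'k::field) \<Rightarrow> (dqp \<Rightarrow>\<^sub>0 'k) \<Rightarrow> 'k" where
  "pic_form x y = bilinear_ext (*) (\<lambda>p q. of_nat (num_pictures p q)) x y"

definition prepic_form :: "(dqp \<Rightarrow>\<^sub>0 'k::field) \<Rightarrow> (dqp \<Rightarrow>\<^sub>0 'k) \<Rightarrow> 'k" where
  "prepic_form x y = bilinear_ext (*) (\<lambda>p q. of_nat (num_prepictures p q)) x y"

lemma scale_1: "scale 1 x = x"
  by (rule poly_mapping_eqI) (simp add: scale_def Poly_Mapping.map.rep_eq when_def)

lemma basis_products:
  fixes P Q :: "nat double_quasi_poset"
  assumes "is_dqp P" "is_dqp Q"
  defines "e \<equiv> (\<lambda>R. Poly_Mapping.single (abs_dqp R) (1 :: 'k::field))"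
  shows "e P \<unlhd> e Q = (\<Sum>f\<in>semi_pictures P Q. e (prod_over P f Q))"
    and "e P \<lhd> e Q = (\<Sum>f\<in>semi_prepictures P Q. e (prod_over P f Q))"
    and "pic_form (e P) (e Q) = of_nat (card (pictures P Q))"
    and "prepic_form (e P) (e Q) = of_nat (card (prepictures P Q))"
proof -
  have r: "dqp_rel P P" "dqp_rel Q Q" using assms by (auto simp: dqp_rel_def dqp_iso_refl)
  show "e P \<unlhd> e Q = (\<Sum>f\<in>semi_pictures P Q. e (prod_over P f Q))"
    and "e P \<lhd> e Q = (\<Sum>f\<in>semi_prepictures P Q. e (prod_over P f Q))"
    and "pic_form (e P) (e Q) = of_nat (card (pictures P Q))"
    and "prepic_form (e P) (e Q) = of_nat (card (prepictures P Q))"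
    by (simp_all add: e_def unlhd_def lhd_def pic_form_def prepic_form_def bilinear_ext_def scale_1
        unlhd_basis.abs_eq[OF r] lhd_basis.abs_eq[OF r] num_pictures.abs_eq[OF r]
        num_prepictures.abs_eq[OF r])
qed

end

theory Submission
  imports Defs
begin

text \<open>Everything is multilinear, so it suffices to compare both sides on basis elements. For
  \<open>f \<in> I(P, Q)\<close>, the first preorder of \<open>P \<times>\<^sub>f Q\<close> is pulled back from \<open>Q\<close> along \<open>f\<close>, so that
  \<open>h \<mapsto> h \<circ> f\<close> is a bijection from \<open>I(Q, R)\<close> to \<open>I(P \<times>\<^sub>f Q, R)\<close>; and \<open>I(P, Q \<times>\<^sub>h R) = I(P, Q)\<close>, as
  \<open>Q\<close> and \<open>Q \<times>\<^sub>h R\<close> have the same second preorder. Hence both sides of associativity are sums over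
  \<open>(f, h) \<in> I(P, Q) \<times> I(Q, R)\<close>, with equal summands. For the pairings, both sides count the pairs
  \<open>(f, h)\<close> such that the inverse of \<open>h \<circ> f\<close> lies in \<open>I(R, P)\<close>. The argument with \<open>I\<^sub><\<close> in place of
  \<open>I\<close> is the same.\<close>

section \<open>Composition of bijections and products over bijections\<close>

lemma bij_betw_compose_bijections:
  assumes "f \<in> bijections A B"
  shows "bij_betw (\<lambda>h. compose A h f) (bijections B C) (bijections A C)"
proof (rule bij_betw_byWitness[where f' = "\<lambda>g. compose B g (inv_into A f)"])
  have f: "bij_betw f A B" using assms by (simp add: bijections_def)
  show "\<forall>h\<in>bijections B C. compose B (compose A h f) (inv_into A f) = h"
    using f by (auto simp: bijections_def compose_def bij_betw_def inv_into_into f_inv_into_f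
        intro!: extensionalityI[where A = B])
  show "\<forall>g\<in>bijections A C. compose A (compose B g (inv_into A f)) f = g"
    using f by (auto simp: bijections_def compose_def bij_betw_def inv_into_f_f
        intro!: extensionalityI[where A = A])
  show "(\<lambda>h. compose A h f) ` bijections B C \<subseteq> bijections A C"
    using f by (auto simp: bijections_def intro: bij_betw_compose)
  show "(\<lambda>g. compose B g (inv_into A f)) ` bijections A C \<subseteq> bijections B C"
    using bij_betw_inv_into[OF f] by (auto simp: bijections_def intro: bij_betw_compose)
qed

text \<open>Pulls conditions on the vertices of \<open>Q\<close> back to those of \<open>P\<close>,
  so that the conditions on \<open>h\<close> and on \<open>h\<close> after \<open>f\<close> range
  over the same pairs.\<close>

lemma ball_bijections:
  assumes "f \<in> bijections A B"
  shows "(\<forall>i\<in>B. \<forall>j\<in>B. C i j) \<longleftrightarrow> (\<forall>i\<in>A. \<forall>j\<in>A. C (f i) (f j))"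
  using assms by (auto simp: bijections_def bij_betw_def)

lemma prod_over_simps [simp]:
  "verts (prod_over P f Q) = verts P"
  "le2 (prod_over P f Q) = le2 P"
  by (simp_all add: prod_over_def)

lemma le1_prod_over_iff:
  assumes "i \<in> verts P" "j \<in> verts P"
  shows "(i, j) \<in> le1 (prod_over P f Q) \<longleftrightarrow> (f i, f j) \<in> le1 Q"
    and "less_wrt (le1 (prod_over P f Q)) i j \<longleftrightarrow> less_wrt (le1 Q) (f i) (f j)"
  using assms by (simp_all add: prod_over_def less_wrt_def equiv_wrt_def)

text \<open>Both sides keep the second preorder of \<open>P\<close> and pull the first preorder of
  \<open>R\<close> back along \<open>h\<close> after \<open>f\<close>; they are equal as records,
  not merely isomorphic.\<close>

lemma prod_over_assoc:
  assumes "f \<in> bijections (verts P) (verts Q)"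
  shows "prod_over (prod_over P f Q) (compose (verts P) h f) R = prod_over P f (prod_over Q h R)"
  using assms by (auto simp: prod_over_def compose_eq bijections_def bij_betw_apply)

lemma semi_pictures_prod_over_right [simp]:
  "semi_pictures P (prod_over Q h R) = semi_pictures P Q"
  by (simp add: semi_pictures_def)

lemma semi_prepictures_prod_over_right [simp]:
  "semi_prepictures P (prod_over Q h R) = semi_prepictures P Q"
  by (simp add: semi_prepictures_def)

lemma bij_betw_semi_pictures_prod_over:
  assumes f: "f \<in> bijections (verts P) (verts Q)"
  shows "bij_betw (\<lambda>h. compose (verts P) h f) (semi_pictures Q R) (semi_pictures (prod_over P f Q) R)"
  unfolding semi_pictures_def prod_over_simps
  by (rule bij_betw_Collect[OF bij_betw_compose_bijections[OF f]])
    (simp add: ball_bijections[OF f] le1_prod_over_iff compose_eq)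

lemma bij_betw_semi_prepictures_prod_over:
  assumes f: "f \<in> bijections (verts P) (verts Q)"
  shows "bij_betw (\<lambda>h. compose (verts P) h f) (semi_prepictures Q R)
    (semi_prepictures (prod_over P f Q) R)"
  unfolding semi_prepictures_def prod_over_simps
  by (rule bij_betw_Collect[OF bij_betw_compose_bijections[OF f]])
    (simp add: ball_bijections[OF f] le1_prod_over_iff compose_eq)

lemma finite_semi_pictures:
  assumes "is_dqp P" "is_dqp Q"
  shows "finite (semi_pictures P Q)" "finite (semi_prepictures P Q)"
  using assms finite_bijections pics_subset(1,2) unfolding is_dqp_def
  by (metis finite_subset)+

section \<open>Associativity and adjunction for fixed representatives\<close>

lemma sum_semi_pictures_assoc:
  "(\<Sum>f\<in>semi_pictures P Q. \<Sum>g\<in>semi_pictures (prod_over P f Q) R.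
      F (prod_over (prod_over P f Q) g R)) =
    (\<Sum>h\<in>semi_pictures Q R. \<Sum>f\<in>semi_pictures P (prod_over Q h R).
      F (prod_over P f (prod_over Q h R)))"
proof -
  have "(\<Sum>g\<in>semi_pictures (prod_over P f Q) R. F (prod_over (prod_over P f Q) g R)) =
      (\<Sum>h\<in>semi_pictures Q R. F (prod_over P f (prod_over Q h R)))"
    if "f \<in> semi_pictures P Q" for f
  proof -
    have f: "f \<in> bijections (verts P) (verts Q)" using that pics_subset(1) by blast
    show ?thesis
      by (simp add: sum.reindex_bij_betw[OF bij_betw_semi_pictures_prod_over[OF f], symmetric]
          prod_over_assoc[OF f])
  qed
  \<comment> \<open>Neither index set depends on the other variable any more, since
    \<open>semi_pictures P (prod_over Q h R)\<close> simplifies to \<open>semi_pictures P Q\<close>;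
    it remains to exchange the two sums.\<close>
  then show ?thesis by (simp add: sum.swap[of _ "semi_pictures P Q"])
qed

lemma sum_semi_prepictures_assoc:
  "(\<Sum>f\<in>semi_prepictures P Q. \<Sum>g\<in>semi_prepictures (prod_over P f Q) R.
      F (prod_over (prod_over P f Q) g R)) =
    (\<Sum>h\<in>semi_prepictures Q R. \<Sum>f\<in>semi_prepictures P (prod_over Q h R).
      F (prod_over P f (prod_over Q h R)))"
proof -
  have "(\<Sum>g\<in>semi_prepictures (prod_over P f Q) R. F (prod_over (prod_over P f Q) g R)) =
      (\<Sum>h\<in>semi_prepictures Q R. F (prod_over P f (prod_over Q h R)))"
    if "f \<in> semi_prepictures P Q" for f
  proof -
    have f: "f \<in> bijections (verts P) (verts Q)" using that pics_subset(2) by blast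
    show ?thesis
      by (simp add: sum.reindex_bij_betw[OF bij_betw_semi_prepictures_prod_over[OF f], symmetric]
          prod_over_assoc[OF f])
  qed
  then show ?thesis by (simp add: sum.swap[of _ "semi_prepictures P Q"])
qed

text \<open>Double counting of the pairs satisfying \<open>C\<close>.\<close>

lemma sum_card_swap:
  assumes "finite A" "finite B"
  shows "(\<Sum>a\<in>A. card {b \<in> B. C a b}) = (\<Sum>b\<in>B. card {a \<in> A. C a b})"
  using sum.swap_restrict[OF assms, of "\<lambda>_ _. 1 :: nat" C] by simp

lemma sum_card_pictures:
  assumes "is_dqp P" "is_dqp Q" "is_dqp R"
  shows "(\<Sum>f\<in>semi_pictures P Q. card (pictures (prod_over P f Q) R)) =
    (\<Sum>h\<in>semi_pictures Q R. card (pictures P (prod_over Q h R)))"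
proof -
  \<comment> \<open>\<open>C g\<close> says that the inverse of \<open>g\<close> is a semi-picture.\<close>
  define C where "C g \<longleftrightarrow> (\<forall>i\<in>verts P. \<forall>j\<in>verts P.
      (less_wrt (le1 R) (g i) (g j) \<longrightarrow> less_wrt (le2 P) i j) \<and>
      ((g i, g j) \<in> le1 R \<longrightarrow> (i, j) \<in> le2 P))" for g
  have left: "card (pictures (prod_over P f Q) R) =
      card {h \<in> semi_pictures Q R. C (compose (verts P) h f)}"
    if "f \<in> semi_pictures P Q" for f
  proof -
    have f: "f \<in> bijections (verts P) (verts Q)" using that pics_subset(1) by blast
    have "pictures (prod_over P f Q) R = {g \<in> semi_pictures (prod_over P f Q) R. C g}"
      by (auto simp: pictures_def prepictures_def semi_pictures_def C_def)
    then show ?thesis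
      by (auto intro!: bij_betw_same_card[symmetric]
          bij_betw_Collect[OF bij_betw_semi_pictures_prod_over[OF f]])
  qed
  \<comment> \<open>Pulling the first preorder of \<open>prod_over Q h R\<close> back along
    \<open>f\<close> amounts to pulling that of \<open>R\<close> back along \<open>h\<close> after
    \<open>f\<close>, so the conditions on the inverse of \<open>f\<close> turn into
    \<open>C\<close> of the composite.\<close>
  have right: "pictures P (prod_over Q h R) = {f \<in> semi_pictures P Q. C (compose (verts P) h f)}" for h
  proof -
    have "f i \<in> verts Q" if "f \<in> bijections (verts P) (verts Q)" "i \<in> verts P" for f i
      using that by (auto simp: bijections_def bij_betw_apply)
    then show ?thesis
      by (auto simp: pictures_def prepictures_def semi_pictures_def C_def compose_eq le1_prod_over_iff)
  qed
  show ?thesis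
    using sum_card_swap[of "semi_pictures P Q" "semi_pictures Q R" "\<lambda>f h. C (compose (verts P) h f)"]
      finite_semi_pictures[OF assms(1,2)] finite_semi_pictures[OF assms(2,3)]
    by (simp add: left right)
qed

lemma sum_card_prepictures:
  assumes "is_dqp P" "is_dqp Q" "is_dqp R"
  shows "(\<Sum>f\<in>semi_prepictures P Q. card (prepictures (prod_over P f Q) R)) =
    (\<Sum>h\<in>semi_prepictures Q R. card (prepictures P (prod_over Q h R)))"
proof -
  \<comment> \<open>For a bijection \<open>g\<close> onto \<open>verts R\<close>, this says that the
    inverse of \<open>g\<close> is a semi-prepicture from \<open>R\<close> to
    \<open>P\<close>.\<close>
  define C where "C g \<longleftrightarrow> (\<forall>i\<in>verts P. \<forall>j\<in>verts P.
      less_wrt (le1 R) (g i) (g j) \<longrightarrow> less_wrt (le2 P) i j)" for g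
  have left: "card (prepictures (prod_over P f Q) R) =
      card {h \<in> semi_prepictures Q R. C (compose (verts P) h f)}"
    if "f \<in> semi_prepictures P Q" for f
  proof -
    have f: "f \<in> bijections (verts P) (verts Q)" using that pics_subset(2) by blast
    have "prepictures (prod_over P f Q) R = {g \<in> semi_prepictures (prod_over P f Q) R. C g}"
      by (auto simp: prepictures_def semi_prepictures_def C_def)
    then show ?thesis
      by (auto intro!: bij_betw_same_card[symmetric]
          bij_betw_Collect[OF bij_betw_semi_prepictures_prod_over[OF f]])
  qed
  have right: "prepictures P (prod_over Q h R) = {f \<in> semi_prepictures P Q. C (compose (verts P) h f)}"
    for h
  proof -
    have "f i \<in> verts Q" if "f \<in> bijections (verts P) (verts Q)" "i \<in> verts P" for f i
      using that by (auto simp: bijections_def bij_betw_apply)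
    then show ?thesis
      by (auto simp: prepictures_def semi_prepictures_def C_def compose_eq le1_prod_over_iff)
  qed
  show ?thesis
    using sum_card_swap[of "semi_prepictures P Q" "semi_prepictures Q R"
        "\<lambda>f h. C (compose (verts P) h f)"]
      finite_semi_pictures[OF assms(1,2)] finite_semi_pictures[OF assms(2,3)]
    by (simp add: left right)
qed

section \<open>Linear and bilinear extension from the basis\<close>

lemma lookup_scale [simp]: "Poly_Mapping.lookup (scale c x) p = c * Poly_Mapping.lookup x p"
  by (simp add: scale_def Poly_Mapping.map.rep_eq when_def)

lemma module_scale: "module (scale :: 'k::field \<Rightarrow> _)"
  by unfold_locales (auto intro!: poly_mapping_eqI simp: lookup_add algebra_simps)

text \<open>The field as a module over itself is the target of the two forms.\<close>

lemma module_times: "module ((*) :: 'k::field \<Rightarrow> _)"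
  by unfold_locales (auto simp: algebra_simps)

text \<open>Coefficients outside the support vanish, so sums for different vectors can be taken over
  one common index set.\<close>

lemma sum_keys_superset:
  assumes "module s" "finite A" "Poly_Mapping.keys x \<subseteq> A"
  shows "(\<Sum>p\<in>Poly_Mapping.keys x. s (Poly_Mapping.lookup x p) (g p)) =
    (\<Sum>p\<in>A. s (Poly_Mapping.lookup x p) (g p))"
  using assms by (intro sum.mono_neutral_left) (auto simp: module.scale_zero_left in_keys_iff)

lemma module_hom_linear_ext:
  fixes s :: "'k::field \<Rightarrow> 'v::ab_group_add \<Rightarrow> 'v"
  assumes "module s"
  shows "module_hom scale s (\<lambda>x. \<Sum>p\<in>Poly_Mapping.keys x. s (Poly_Mapping.lookup x p) (g p))"
proof -
  interpret module s by fact
  show ?thesis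
  proof (rule module_hom.intro[OF module_scale assms], unfold_locales)
    fix x y :: "dqp \<Rightarrow>\<^sub>0 'k" and c
    note superset = sum_keys_superset[OF assms, where g = g]
    \<comment> \<open>Cancellation can make the support of \<open>x + y\<close> smaller than this
      union, so all three sums are taken over the union.\<close>
    let ?A = "Poly_Mapping.keys x \<union> Poly_Mapping.keys y"
    have "Poly_Mapping.keys (x + y) \<subseteq> ?A" by (rule Poly_Mapping.keys_add)
    then have eqs: "(\<Sum>p\<in>Poly_Mapping.keys w. s (Poly_Mapping.lookup w p) (g p)) =
        (\<Sum>p\<in>?A. s (Poly_Mapping.lookup w p) (g p))" if "w \<in> {x, y, x + y}" for w
      using that superset[of ?A w] by auto
    show "(\<Sum>p\<in>Poly_Mapping.keys (x + y). s (Poly_Mapping.lookup (x + y) p) (g p)) =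
        (\<Sum>p\<in>Poly_Mapping.keys x. s (Poly_Mapping.lookup x p) (g p)) +
        (\<Sum>p\<in>Poly_Mapping.keys y. s (Poly_Mapping.lookup y p) (g p))"
      by (subst (1 2 3) eqs) (simp_all add: lookup_add scale_left_distrib sum.distrib)
    have "Poly_Mapping.keys (scale c x) \<subseteq> Poly_Mapping.keys x"
      by (auto simp: in_keys_iff)
    then show "(\<Sum>p\<in>Poly_Mapping.keys (scale c x). s (Poly_Mapping.lookup (scale c x) p) (g p)) =
        s c (\<Sum>p\<in>Poly_Mapping.keys x. s (Poly_Mapping.lookup x p) (g p))"
      by (subst superset[of "Poly_Mapping.keys x" "scale c x"]) (simp_all add: scale_sum_right)
  qed
qed

lemma module_hom_bilinear_ext:
  fixes s :: "'k::field \<Rightarrow> 'v::ab_group_add \<Rightarrow> 'v"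
  assumes "module s"
  shows "module_hom scale s (\<lambda>x. bilinear_ext s B x y)"
    and "module_hom scale s (\<lambda>y. bilinear_ext s B x y)"
proof -
  interpret module s by fact
  have "(\<lambda>x. bilinear_ext s B x y) = (\<lambda>x. \<Sum>p\<in>Poly_Mapping.keys x. s (Poly_Mapping.lookup x p)
      (\<Sum>q\<in>Poly_Mapping.keys y. s (Poly_Mapping.lookup y q) (B p q)))"
    by (simp add: bilinear_ext_def scale_sum_right)
  then show "module_hom scale s (\<lambda>x. bilinear_ext s B x y)"
    using module_hom_linear_ext[OF assms] by simp
  \<comment> \<open>With \<open>x\<close> fixed, exchanging the sums and commuting the scalars
    exhibits the map as a linear extension in \<open>y\<close>.\<close>
  have "(\<lambda>y. bilinear_ext s B x y) = (\<lambda>y. \<Sum>q\<in>Poly_Mapping.keys y. s (Poly_Mapping.lookup y q)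
      (\<Sum>p\<in>Poly_Mapping.keys x. s (Poly_Mapping.lookup x p) (B p q)))"
    by (simp add: bilinear_ext_def scale_sum_right sum.swap[of _ "Poly_Mapping.keys x"] mult.commute)
  then show "module_hom scale s (\<lambda>y. bilinear_ext s B x y)"
    using module_hom_linear_ext[OF assms] by simp
qed

lemma module_hom_products:
  fixes x y :: "dqp \<Rightarrow>\<^sub>0 'k::field"
  shows "module_hom scale scale (\<lambda>x. x \<unlhd> y)" "module_hom scale scale (\<lambda>y. x \<unlhd> y)"
    "module_hom scale scale (\<lambda>x. x \<lhd> y)" "module_hom scale scale (\<lambda>y. x \<lhd> y)"
    "module_hom scale (*) (\<lambda>x. pic_form x y)" "module_hom scale (*) (\<lambda>y. pic_form x y)"
    "module_hom scale (*) (\<lambda>x. prepic_form x y)" "module_hom scale (*) (\<lambda>y. prepic_form x y)"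
  by (simp_all only: unlhd_def lhd_def pic_form_def prepic_form_def
      module_hom_bilinear_ext[OF module_scale] module_hom_bilinear_ext[OF module_times])

lemma module_hom_eq_on_basis:
  fixes f g :: "(dqp \<Rightarrow>\<^sub>0 'k::field) \<Rightarrow> 'v::ab_group_add"
  assumes f: "module_hom scale s f" and g: "module_hom scale s g"
    and eq: "\<And>P. is_dqp P \<Longrightarrow>
      f (Poly_Mapping.single (abs_dqp P) 1) = g (Poly_Mapping.single (abs_dqp P) 1)"
  shows "f x = g x"
proof -
  \<comment> \<open>The quotient is partial, so its chosen representatives satisfy
    \<open>is_dqp\<close>.\<close>
  have basis: "f (Poly_Mapping.single p 1) = g (Poly_Mapping.single p 1)" for p
    using eq[of "rep_dqp p"] Quotient3_rep_reflp[OF Quotient3_dqp, of p]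
      Quotient3_abs_rep[OF Quotient3_dqp, of p] by (simp add: dqp_rel_def)
  have x: "x = (\<Sum>p\<in>Poly_Mapping.keys x. scale (Poly_Mapping.lookup x p) (Poly_Mapping.single p 1))"
    by (rule poly_mapping_eqI)
      (simp add: lookup_sum lookup_single when_def in_keys_iff if_distrib cong: if_cong)
  show ?thesis
    by (subst (1 2) x) (simp only: module_hom.sum[OF f] module_hom.sum[OF g]
        module_hom.scale[OF f] module_hom.scale[OF g] basis)
qed

text \<open>Frees \<open>z\<close>, then \<open>y\<close>, then \<open>x\<close> from the basis. The
  target is left general to serve both the products and the forms.\<close>

lemma trilinear_eq_on_basis:
  fixes F G :: "(dqp \<Rightarrow>\<^sub>0 'k::field) \<Rightarrow> (dqp \<Rightarrow>\<^sub>0 'k) \<Rightarrow> (dqp \<Rightarrow>\<^sub>0 'k) \<Rightarrow> 'v::ab_group_add"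
  defines "e \<equiv> (\<lambda>P. Poly_Mapping.single (abs_dqp P) (1 :: 'k))"
  assumes F: "\<And>y z. module_hom scale s (\<lambda>x. F x y z)" "\<And>x z. module_hom scale s (\<lambda>y. F x y z)"
    "\<And>x y. module_hom scale s (\<lambda>z. F x y z)"
    and G: "\<And>y z. module_hom scale s (\<lambda>x. G x y z)" "\<And>x z. module_hom scale s (\<lambda>y. G x y z)"
    "\<And>x y. module_hom scale s (\<lambda>z. G x y z)"
    and eq: "\<And>P Q R. is_dqp P \<Longrightarrow> is_dqp Q \<Longrightarrow> is_dqp R \<Longrightarrow> F (e P) (e Q) (e R) = G (e P) (e Q) (e R)"
  shows "F x y z = G x y z"
proof -
  have "F (e P) (e Q) z = G (e P) (e Q) z" if "is_dqp P" "is_dqp Q" for P Q z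
    by (rule module_hom_eq_on_basis[OF F(3) G(3)]) (use eq that in \<open>simp add: e_def\<close>)
  then have "F (e P) y z = G (e P) y z" if "is_dqp P" for P y z
    unfolding e_def by (rule module_hom_eq_on_basis[OF F(2) G(2)]) (use that in simp)
  then show ?thesis
    unfolding e_def by (rule module_hom_eq_on_basis[OF F(1) G(1)])
qed

text \<open>Linearity in each variable of the nested expressions in the four identities.\<close>

lemmas module_hom_product_comps =
  module_hom_products
  module_hom_compose[OF module_hom_products(1), unfolded o_def]
  module_hom_compose[OF module_hom_products(2), unfolded o_def]
  module_hom_compose[OF module_hom_products(3), unfolded o_def]
  module_hom_compose[OF module_hom_products(4), unfolded o_def]

text \<open>A product of basis elements is a sum, over which the outer product or form has to be
  distributed.\<close>

lemmas product_sums = module_hom_products[THEN module_hom.sum]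

theorem proposition29:
  fixes x y z :: "dqp \<Rightarrow>\<^sub>0 'k::field"
  shows "(x \<unlhd> y) \<unlhd> z = x \<unlhd> (y \<unlhd> z) \<and>
    (x \<lhd> y) \<lhd> z = x \<lhd> (y \<lhd> z) \<and>
    pic_form (x \<unlhd> y) z = pic_form x (y \<unlhd> z) \<and>
    prepic_form (x \<lhd> y) z = prepic_form x (y \<lhd> z)"
proof (intro conjI)
  have subs: "f \<in> semi_pictures P Q \<Longrightarrow> f \<in> bijections (verts P) (verts Q)"
    "f \<in> semi_prepictures P Q \<Longrightarrow> f \<in> bijections (verts P) (verts Q)"
    for f and P Q :: "nat double_quasi_poset"
    using pics_subset(1,2) by blast+
  show "(x \<unlhd> y) \<unlhd> z = x \<unlhd> (y \<unlhd> z)"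
    by (rule trilinear_eq_on_basis[where s = scale and F = "\<lambda>x y z. (x \<unlhd> y) \<unlhd> z"
          and G = "\<lambda>x y z. x \<unlhd> (y \<unlhd> z)"])
      (auto intro: module_hom_product_comps simp: basis_products product_sums is_dqp_prod_over
        subs sum_semi_pictures_assoc[where F = "\<lambda>S. Poly_Mapping.single (abs_dqp S) 1"] simp del: semi_pictures_prod_over_right)
  show "(x \<lhd> y) \<lhd> z = x \<lhd> (y \<lhd> z)"
    by (rule trilinear_eq_on_basis[where s = scale and F = "\<lambda>x y z. (x \<lhd> y) \<lhd> z"
          and G = "\<lambda>x y z. x \<lhd> (y \<lhd> z)"])
      (auto intro: module_hom_product_comps simp: basis_products product_sums is_dqp_prod_over
        subs sum_semi_prepictures_assoc[where F = "\<lambda>S. Poly_Mapping.single (abs_dqp S) 1"] simp del: semi_prepictures_prod_over_right)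
  \<comment> \<open>On basis elements this is the image under \<open>of_nat\<close> of an identity
    of natural numbers, whatever the characteristic.\<close>
  show "pic_form (x \<unlhd> y) z = pic_form x (y \<unlhd> z)"
    by (rule trilinear_eq_on_basis[where s = "(*)" and F = "\<lambda>x y z. pic_form (x \<unlhd> y) z"
          and G = "\<lambda>x y z. pic_form x (y \<unlhd> z)"])
      (auto intro: module_hom_product_comps simp: basis_products product_sums is_dqp_prod_over
        subs sum_card_pictures simp flip: of_nat_sum)
  show "prepic_form (x \<lhd> y) z = prepic_form x (y \<lhd> z)"
    by (rule trilinear_eq_on_basis[where s = "(*)" and F = "\<lambda>x y z. prepic_form (x \<lhd> y) z"
          and G = "\<lambda>x y z. prepic_form x (y \<lhd> z)"])
      (auto intro: module_hom_product_comps simp: basis_products product_sums is_dqp_prod_over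
        subs sum_card_prepictures simp flip: of_nat_sum)
qed

end
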